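(* Let $R$ be a ring and let $I$ be a left (resp., right) ideal of $R$. Then an element $a\in R$ is integral over $I$ if and only if there exist $n\ge1$ and $r_0,\dots,r_{n-1}\in I$ such that $$a^n+r_{n-1}a^{n-1}+\cdots+r_1a+r_0=0\quad(\text{resp., } a^n+a^{n-1}r_{n-1}+\cdots+ar_1+r_0=0).$$
   Context: Rings are associative and unital, not necessarily commutative. An element $a\in R$ is said to be integral over a subset $S\subseteq R$ if there exists $n\ge1$ such that $a^n$ can be expressed as a (finite) sum of products $s_1\cdots s_k$, where each $s_i\in S\cup\{a\}$, at least one factor $s_i$ in each product belongs to $S$, and the number of occurrences of $a$ in each product is strictly less than $n$. *)

theory Defs
  imports "HOL-Algebra.Ring" "HOL-Algebra.Ideal"
begin

locale left_ideal = additive_subgroup I R + ring R for I and R (structure) +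
  assumes I_l_closed: "\<lbrakk>a \<in> I; x \<in> carrier R\<rbrakk> \<Longrightarrow> x \<otimes> a \<in> I"

locale right_ideal = additive_subgroup I R + ring R for I and R (structure) +
  assumes I_r_closed: "\<lbrakk>a \<in> I; x \<in> carrier R\<rbrakk> \<Longrightarrow> a \<otimes> x \<in> I"

text \<open>
  The product \<open>s\<^sub>1 \<cdots> s\<^sub>k\<close> is encoded as the list of its factors; the sum has the \<open>m\<close> terms
  \<open>w 0, \<dots>, w (m - 1)\<close>, where the empty sum (\<open>m = 0\<close>) is allowed. Occurrences of \<open>a\<close> are
  counted as ring elements: if \<open>a \<in> S\<close>, a factor equal to \<open>a\<close> is a factor in \<open>S\<close> and
  is also an occurrence of \<open>a\<close>.
\<close>

definition integral_over :: "('a, 'b) ring_scheme \<Rightarrow> 'a set \<Rightarrow> 'a \<Rightarrow> bool" where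
  "integral_over R S a \<longleftrightarrow>
    (\<exists>n::nat. n \<ge> 1 \<and>
      (\<exists>(m::nat) (w :: nat \<Rightarrow> 'a list).
        (\<forall>j<m. set (w j) \<subseteq> S \<union> {a} \<and> set (w j) \<inter> S \<noteq> {} \<and> count_list (w j) a < n) \<and>
        a [^]\<^bsub>R\<^esub> n = (\<Oplus>\<^bsub>R\<^esub>j\<in>{..<m}. foldr (\<otimes>\<^bsub>R\<^esub>) (w j) \<one>\<^bsub>R\<^esub>)))"

end

theory Submission
  imports Defs
begin

text \<open>
  Let \<open>I\<close> be a left ideal. In a product with factors in \<open>I \<union> {a}\<close>, at least one of them in \<open>I\<close>,
  everything up to and including the last factor in \<open>I\<close> multiplies to an element \<open>r\<close> of \<open>I\<close>, and
  what follows is a power \<open>a\<^sup>i\<close>; so the product is a single monomial \<open>r a\<^sup>i\<close>, with \<open>i\<close> at most the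
  number of occurrences of \<open>a\<close>. Collecting the monomials of equal exponent turns a sum of products
  with fewer than \<open>n\<close> occurrences of \<open>a\<close> into a polynomial in \<open>a\<close> of degree less than \<open>n\<close> with left
  coefficients in \<open>I\<close>. For a right ideal, cut at the first factor in \<open>I\<close> instead.

  Conversely, a monomial \<open>r a\<^sup>i\<close> is itself such a product, with \<open>i\<close> occurrences of \<open>a\<close> unless
  \<open>r = a\<close>, in which case there is one more and the bound may fail. That can only
  happen if \<open>a \<in> I\<close>, and then \<open>a\<close> is integral for another reason: \<open>a\<^sup>2\<close> lies in \<open>I\<close>, so it is a
  product with one factor, hence with fewer than two occurrences of \<open>a\<close>.

  The argument is the same on both sides once a monomial is written as \<open>T i r\<close>, standing for
  \<open>r a\<^sup>i\<close> or \<open>a\<^sup>i r\<close>: it uses only that \<open>T\<close> is additive in \<open>r\<close> and that products and monomials can be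
  converted into each other. Lemma \<open>integral_over_iff_monomial_equation\<close> carries it out for any such
  \<open>T\<close>, and the two sides differ only in lemmas \<open>left_ideal_product_is_monomial\<close> and
  \<open>right_ideal_product_is_monomial\<close>.
\<close>

lemma (in ring) foldr_mult_closed:
  assumes "set w \<subseteq> carrier R"
  shows "foldr (\<otimes>) w \<one> \<in> carrier R"
  using assms by (induction w) auto

lemma (in ring) foldr_replicate_append:
  assumes "a \<in> carrier R" "set w \<subseteq> carrier R"
  shows "foldr (\<otimes>) (replicate i a @ w) \<one> = a [^] i \<otimes> foldr (\<otimes>) w \<one>"
proof (induction i)
  case 0
  then show ?case using foldr_mult_closed[OF assms(2)] by simp
next
  case (Suc i)
  then show ?case
    using assms foldr_mult_closed[OF assms(2)]
    by (subst nat_pow_Suc2) (simp_all add: m_assoc)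
qed

lemma (in ring) foldr_replicate:
  assumes "a \<in> carrier R"
  shows "foldr (\<otimes>) (replicate i a) \<one> = a [^] i"
  using foldr_replicate_append[OF assms, of "[]" i] assms by simp

text \<open>
  The cut is at the last factor in \<open>I\<close>. It is found from the left: a factor \<open>x\<close> with a
  further factor in \<open>I\<close> to its right is absorbed into the coefficient, and otherwise \<open>x\<close> itself is
  the coefficient and all factors to its right equal \<open>a\<close>.
\<close>
lemma left_ideal_product_is_monomial:
  fixes R (structure)
  assumes "left_ideal I R" and a: "a \<in> carrier R"
    and "set w \<subseteq> I \<union> {a}" and "set w \<inter> I \<noteq> {}"
  shows "\<exists>i\<le>count_list w a. \<exists>r\<in>I. foldr (\<otimes>) w \<one> = r \<otimes> a [^] i"
  using assms(3,4)
proof (induction w)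
  case Nil
  then show ?case by simp
next
  interpret left_ideal I R by fact
  case (Cons x w)
  have x: "x \<in> carrier R" using Cons.prems a a_subset by auto
  show ?case
  proof (cases "set w \<inter> I = {}")
    case False
    then obtain i r where i: "i \<le> count_list w a" and r: "r \<in> I"
      and eq: "foldr (\<otimes>) w \<one> = r \<otimes> a [^] i"
      using Cons by auto
    have "foldr (\<otimes>) (x # w) \<one> = (x \<otimes> r) \<otimes> a [^] i"
      using eq x r a by (simp add: m_assoc)
    moreover have "x \<otimes> r \<in> I" using I_l_closed r x by simp
    moreover have "i \<le> count_list (x # w) a" using i by simp
    ultimately show ?thesis by blast
  next
    case True
    then have "x \<in> I" and "\<forall>y\<in>set w. y = a" using Cons.prems by auto
    then have w: "w = replicate (length w) a" by (simp add: replicate_length_same)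
    have "foldr (\<otimes>) w \<one> = a [^] length w"
      by (subst w) (rule foldr_replicate[OF a])
    moreover have "count_list w a = length w"
      using \<open>\<forall>y\<in>set w. y = a\<close> by (induction w) auto
    ultimately show ?thesis using \<open>x \<in> I\<close>
      by (intro exI[of _ "length w"]) auto
  qed
qed

text \<open>
  The cut is at the first factor in \<open>I\<close>, which absorbs all factors to its right; the
  factors before it equal \<open>a\<close>.
\<close>
lemma right_ideal_product_is_monomial:
  fixes R (structure)
  assumes "right_ideal I R" and a: "a \<in> carrier R"
    and "set w \<subseteq> I \<union> {a}" and "set w \<inter> I \<noteq> {}"
  shows "\<exists>i\<le>count_list w a. \<exists>r\<in>I. foldr (\<otimes>) w \<one> = a [^] i \<otimes> r"
  using assms(3,4)
proof (induction w)
  case Nil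
  then show ?case by simp
next
  interpret right_ideal I R by fact
  case (Cons x w)
  show ?case
  proof (cases "x \<in> I")
    case True
    have w: "foldr (\<otimes>) w \<one> \<in> carrier R"
      using Cons.prems a a_subset by (intro foldr_mult_closed) auto
    have "x \<otimes> foldr (\<otimes>) w \<one> \<in> I" using I_r_closed True w by simp
    then show ?thesis using a_subset by (intro exI[of _ 0]) auto
  next
    case False
    then have x: "x = a" and "set w \<inter> I \<noteq> {}" using Cons.prems by auto
    then obtain i r where i: "i \<le> count_list w a" and r: "r \<in> I"
      and eq: "foldr (\<otimes>) w \<one> = a [^] i \<otimes> r"
      using Cons by auto
    have "r \<in> carrier R" using r a_subset by auto
    then have "foldr (\<otimes>) (x # w) \<one> = a [^] Suc i \<otimes> r"
      using eq x a by (subst nat_pow_Suc2) (simp_all add: m_assoc)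
    moreover have "Suc i \<le> count_list (x # w) a" using i x by simp
    ultimately show ?thesis using r by blast
  qed
qed

text \<open>
  The sums \<open>T 0 (r 0) + \<dots> + T (n - 1) (r (n - 1))\<close> with coefficients in \<open>I\<close> are closed under
  addition, since \<open>T\<close> is additive in its coefficient, and they include each single monomial
  \<open>T k s\<close> with \<open>k < n\<close>, padded with zero coefficients.
\<close>
lemma (in ring) collect_monomials:
  fixes T :: "nat \<Rightarrow> 'a \<Rightarrow> 'a"
  assumes "additive_subgroup I R"
    and closed: "\<And>i r. r \<in> I \<Longrightarrow> T i r \<in> carrier R"
    and add: "\<And>i r s. r \<in> I \<Longrightarrow> s \<in> I \<Longrightarrow> T i (r \<oplus> s) = T i r \<oplus> T i s"
    and zero: "\<And>i. T i \<zero> = \<zero>"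
    and f: "\<And>j. j < (m::nat) \<Longrightarrow> \<exists>i<n. \<exists>r\<in>I. f j = T i r"
  shows "\<exists>r. (\<forall>i<n. r i \<in> I) \<and> (\<Oplus>j\<in>{..<m}. f j) = (\<Oplus>i\<in>{..<n}. T i (r i))"
proof -
  interpret I: additive_subgroup I R by fact
  show ?thesis using f
  proof (induction m)
    case 0
    show ?case by (intro exI[of _ "\<lambda>_. \<zero>"]) (simp add: zero)
  next
    case (Suc m)
    then obtain r where r: "\<And>i. i < n \<Longrightarrow> r i \<in> I"
      and eq: "(\<Oplus>j\<in>{..<m}. f j) = (\<Oplus>i\<in>{..<n}. T i (r i))"
      by fastforce
    obtain k s where k: "k < n" and s: "s \<in> I" and fm: "f m = T k s"
      using Suc.prems by blast
    let ?d = "\<lambda>i. if i = k then s else \<zero>"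
    have fc: "f j \<in> carrier R" if "j < Suc m" for j
      using Suc.prems[OF that] closed by auto
    have "(\<Oplus>i\<in>{..<n}. T i (?d i)) = (\<Oplus>i\<in>{..<n}. if k = i then T i s else \<zero>)"
      using s closed zero by (intro finsum_cong') auto
    also have "\<dots> = T k s"
      using k s closed by (subst finsum_singleton) auto
    finally have single: "(\<Oplus>i\<in>{..<n}. T i (?d i)) = T k s" .
    have "(\<Oplus>j\<in>{..<Suc m}. f j) = f m \<oplus> (\<Oplus>j\<in>{..<m}. f j)"
      using fc by (simp add: lessThan_Suc finsum_insert Pi_def)
    also have "\<dots> = (\<Oplus>i\<in>{..<n}. T i (?d i)) \<oplus> (\<Oplus>i\<in>{..<n}. T i (r i))"
      unfolding fm eq single ..
    also have "\<dots> = (\<Oplus>i\<in>{..<n}. T i (?d i) \<oplus> T i (r i))"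
      using r s closed by (subst finsum_addf) auto
    also have "\<dots> = (\<Oplus>i\<in>{..<n}. T i (?d i \<oplus> r i))"
      using r s closed by (intro finsum_cong') (auto simp: add)
    finally show ?case
      using r s by (intro exI[of _ "\<lambda>i. ?d i \<oplus> r i"]) auto
  qed
qed

text \<open>
  The last hypothesis bounds the occurrences of \<open>a\<close> only for coefficients in \<open>I\<close> different from \<open>a\<close>,
  because a coefficient equal to \<open>a\<close> would count as one more; the case \<open>a \<in> I\<close> is settled by
  \<open>a\<^sup>2 \<in> I\<close> instead.
\<close>
lemma (in ring) integral_over_iff_monomial_equation:
  fixes T :: "nat \<Rightarrow> 'a \<Rightarrow> 'a"
  assumes "additive_subgroup I R" and a: "a \<in> carrier R"
    and square: "a \<in> I \<Longrightarrow> a \<otimes> a \<in> I"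
    and closed: "\<And>i r. r \<in> I \<Longrightarrow> T i r \<in> carrier R"
    and add: "\<And>i r s. r \<in> I \<Longrightarrow> s \<in> I \<Longrightarrow> T i (r \<oplus> s) = T i r \<oplus> T i s"
    and product_is_monomial:
      "\<And>w. set w \<subseteq> I \<union> {a} \<Longrightarrow> set w \<inter> I \<noteq> {} \<Longrightarrow>
        \<exists>i\<le>count_list w a. \<exists>r\<in>I. foldr (\<otimes>) w \<one> = T i r"
    and monomial_is_product:
      "\<And>i r. r \<in> I \<Longrightarrow> r \<noteq> a \<Longrightarrow> \<exists>w. set w \<subseteq> I \<union> {a} \<and> set w \<inter> I \<noteq> {} \<and>
        count_list w a \<le> i \<and> foldr (\<otimes>) w \<one> = T i r"
  shows "integral_over R I a \<longleftrightarrow>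
    (\<exists>(n::nat) (r :: nat \<Rightarrow> 'a). n \<ge> 1 \<and> (\<forall>i<n. r i \<in> I) \<and>
      a [^] n \<oplus> (\<Oplus>i\<in>{..<n}. T i (r i)) = \<zero>)"
proof -
  interpret I: additive_subgroup I R by fact
  have zero: "T i \<zero> = \<zero>" for i
    using add[of \<zero> \<zero> i] closed[of \<zero> i] by (simp add: local.add.r_cancel_one)
  have T_neg: "T i (\<ominus> r) = \<ominus> T i r" if "r \<in> I" for i r
  proof -
    have r: "\<ominus> r \<in> I" "r \<in> carrier R" using that I.a_subset by auto
    then have "T i (\<ominus> r) \<oplus> T i r = \<zero>"
      using add[of "\<ominus> r" r i] that zero by (simp add: l_neg)
    then show ?thesis using closed that r by (simp add: minus_equality)
  qed
  have neg_sum: "(\<Oplus>i\<in>{..<n}. T i (\<ominus> r i)) = \<ominus> (\<Oplus>i\<in>{..<n}. T i (r i))"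
    if r: "\<forall>i<n. r i \<in> I" for n :: nat and r
  proof -
    have c: "(\<lambda>i. T i (r i)) \<in> {..<n} \<rightarrow> carrier R" "(\<lambda>i. T i (\<ominus> r i)) \<in> {..<n} \<rightarrow> carrier R"
      using r closed by auto
    have "(\<Oplus>i\<in>{..<n}. T i (\<ominus> r i)) \<oplus> (\<Oplus>i\<in>{..<n}. T i (r i))
        = (\<Oplus>i\<in>{..<n}. T i (\<ominus> r i) \<oplus> T i (r i))"
      using c by (simp add: finsum_addf)
    also have "\<dots> = (\<Oplus>i\<in>{..<n}. \<zero>)"
      using r closed by (intro finsum_cong') (auto simp: T_neg l_neg)
    finally show ?thesis using c by (simp add: minus_equality)
  qed
  show ?thesis
  proof
    assume "integral_over R I a"
    then obtain n m :: nat and w :: "nat \<Rightarrow> 'a list" where n: "n \<ge> 1"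
      and w: "\<forall>j<m. set (w j) \<subseteq> I \<union> {a} \<and> set (w j) \<inter> I \<noteq> {} \<and> count_list (w j) a < n"
      and eq: "a [^] n = (\<Oplus>j\<in>{..<m}. foldr (\<otimes>) (w j) \<one>)"
      unfolding integral_over_def by blast
    have monomial: "\<exists>i<n. \<exists>r\<in>I. foldr (\<otimes>) (w j) \<one> = T i r" if "j < m" for j
    proof -
      have wj: "set (w j) \<subseteq> I \<union> {a}" "set (w j) \<inter> I \<noteq> {}" "count_list (w j) a < n"
        using w that by auto
      obtain i where "i \<le> count_list (w j) a" "\<exists>r\<in>I. foldr (\<otimes>) (w j) \<one> = T i r"
        using product_is_monomial[OF wj(1,2)] by auto
      then show ?thesis using wj(3) by (intro exI[of _ i]) simp
    qed
    have "\<exists>r. (\<forall>i<n. r i \<in> I) \<and> a [^] n = (\<Oplus>i\<in>{..<n}. T i (r i))"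
      unfolding eq
      by (rule collect_monomials[OF \<open>additive_subgroup I R\<close> closed add zero monomial])
    then obtain r where r: "\<forall>i<n. r i \<in> I" and "a [^] n = (\<Oplus>i\<in>{..<n}. T i (r i))"
      by blast
    moreover have "(\<Oplus>i\<in>{..<n}. T i (r i)) \<in> carrier R"
      using r closed by (intro finsum_closed) auto
    ultimately have "a [^] n \<oplus> (\<Oplus>i\<in>{..<n}. T i (\<ominus> r i)) = \<zero>"
      using neg_sum r by (simp add: r_neg)
    then show "\<exists>n r. n \<ge> 1 \<and> (\<forall>i<n. r i \<in> I) \<and> a [^] n \<oplus> (\<Oplus>i\<in>{..<n}. T i (r i)) = \<zero>"
      using n r by (intro exI[of _ n] exI[of _ "\<lambda>i. \<ominus> r i"]) auto
  next
    assume "\<exists>(n::nat) r. n \<ge> 1 \<and> (\<forall>i<n. r i \<in> I) \<and> a [^] n \<oplus> (\<Oplus>i\<in>{..<n}. T i (r i)) = \<zero>"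
    then obtain n :: nat and r where n: "n \<ge> 1" and r: "\<forall>i<n. r i \<in> I"
      and eq: "a [^] n \<oplus> (\<Oplus>i\<in>{..<n}. T i (r i)) = \<zero>" by blast
    show "integral_over R I a"
    proof (cases "a \<in> I")
      case True
      then have sq: "a \<otimes> a \<in> I" by (rule square)
      have eq2: "a [^] (2::nat) = (\<Oplus>j\<in>{..<1::nat}. foldr (\<otimes>) [a \<otimes> a] \<one>)"
        using a by (simp add: numeral_2_eq_2 lessThan_Suc)
      show ?thesis
        unfolding integral_over_def
        by (rule exI[where x = 2], rule conjI, simp, rule exI[where x = 1],
            rule exI[where x = "\<lambda>_. [a \<otimes> a]"], rule conjI[OF _ eq2]) (simp add: sq)
    next
      case False
      have "\<exists>w. set w \<subseteq> I \<union> {a} \<and> set w \<inter> I \<noteq> {} \<and> count_list w a < n \<and>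
          foldr (\<otimes>) w \<one> = T i (\<ominus> r i)" if "i < n" for i
      proof -
        have "\<ominus> r i \<in> I" using r that by simp
        moreover from this have "\<ominus> r i \<noteq> a" using False by auto
        ultimately obtain w where "set w \<subseteq> I \<union> {a}" "set w \<inter> I \<noteq> {}" "count_list w a \<le> i"
          "foldr (\<otimes>) w \<one> = T i (\<ominus> r i)"
          using monomial_is_product[of "\<ominus> r i" i] by auto
        then show ?thesis using that by (intro exI[of _ w]) simp
      qed
      then obtain w where w: "\<And>i. i < n \<Longrightarrow> set (w i) \<subseteq> I \<union> {a} \<and> set (w i) \<inter> I \<noteq> {} \<and>
          count_list (w i) a < n \<and> foldr (\<otimes>) (w i) \<one> = T i (\<ominus> r i)"
        by metis
      have "(\<Oplus>i\<in>{..<n}. T i (r i)) \<in> carrier R"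
        using r closed by (intro finsum_closed) auto
      then have "a [^] n = \<ominus> (\<Oplus>i\<in>{..<n}. T i (r i))"
        using minus_equality[OF eq] a by simp
      also have "\<dots> = (\<Oplus>i\<in>{..<n}. T i (\<ominus> r i))" using neg_sum[OF r] by simp
      also have "\<dots> = (\<Oplus>i\<in>{..<n}. foldr (\<otimes>) (w i) \<one>)"
        using w r closed by (intro finsum_cong') auto
      finally show ?thesis
        unfolding integral_over_def using n w by blast
    qed
  qed
qed

theorem proposition3p1:
  fixes R (structure) and I :: "'a set" and a :: 'a
  assumes "ring R" and "a \<in> carrier R"
  shows
    "(left_ideal I R \<longrightarrow>
       (integral_over R I a \<longleftrightarrow>
         (\<exists>(n::nat) (r :: nat \<Rightarrow> 'a). n \<ge> 1 \<and> (\<forall>i<n. r i \<in> I) \<and>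
            a [^] n \<oplus> (\<Oplus>i\<in>{..<n}. r i \<otimes> a [^] i) = \<zero>))) \<and>
     (right_ideal I R \<longrightarrow>
       (integral_over R I a \<longleftrightarrow>
         (\<exists>(n::nat) (r :: nat \<Rightarrow> 'a). n \<ge> 1 \<and> (\<forall>i<n. r i \<in> I) \<and>
            a [^] n \<oplus> (\<Oplus>i\<in>{..<n}. a [^] i \<otimes> r i) = \<zero>)))"
proof (intro conjI impI)
  interpret ring R by fact
  note a = \<open>a \<in> carrier R\<close>
  {
    assume left: "left_ideal I R"
    then interpret left_ideal I R .
    have carr: "r \<in> carrier R" if "r \<in> I" for r using that a_subset by auto
    show "integral_over R I a \<longleftrightarrow>
      (\<exists>(n::nat) (r :: nat \<Rightarrow> 'a). n \<ge> 1 \<and> (\<forall>i<n. r i \<in> I) \<and>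
        a [^] n \<oplus> (\<Oplus>i\<in>{..<n}. r i \<otimes> a [^] i) = \<zero>)"
    proof (rule integral_over_iff_monomial_equation[where T = "\<lambda>i r. r \<otimes> a [^] i"])
      fix i :: nat and r assume r: "r \<in> I" "r \<noteq> a"
      show "\<exists>w. set w \<subseteq> I \<union> {a} \<and> set w \<inter> I \<noteq> {} \<and> count_list w a \<le> i \<and>
          foldr (\<otimes>) w \<one> = r \<otimes> a [^] i"
        using r foldr_replicate[OF a, of i] count_le_length[of "replicate i a" a]
        by (intro exI[of _ "r # replicate i a"]) auto
    qed (use a carr left left_ideal_product_is_monomial[OF left a] I_l_closed additive_subgroup_axioms
        in \<open>auto simp: l_distr\<close>)
  next
    assume right: "right_ideal I R"
    then interpret right_ideal I R .
    have carr: "r \<in> carrier R" if "r \<in> I" for r using that a_subset by auto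
    show "integral_over R I a \<longleftrightarrow>
      (\<exists>(n::nat) (r :: nat \<Rightarrow> 'a). n \<ge> 1 \<and> (\<forall>i<n. r i \<in> I) \<and>
        a [^] n \<oplus> (\<Oplus>i\<in>{..<n}. a [^] i \<otimes> r i) = \<zero>)"
    proof (rule integral_over_iff_monomial_equation[where T = "\<lambda>i r. a [^] i \<otimes> r"])
      fix i :: nat and r assume r: "r \<in> I" "r \<noteq> a"
      show "\<exists>w. set w \<subseteq> I \<union> {a} \<and> set w \<inter> I \<noteq> {} \<and> count_list w a \<le> i \<and>
          foldr (\<otimes>) w \<one> = a [^] i \<otimes> r"
        using r carr foldr_replicate_append[OF a, of "[r]" i]
          count_le_length[of "replicate i a" a]
        by (intro exI[of _ "replicate i a @ [r]"]) auto
    qed (use a carr right right_ideal_product_is_monomial[OF right a] I_r_closed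
        additive_subgroup_axioms in \<open>auto simp: r_distr\<close>)
  }
qed

end
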